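(* Let $M$ and $N$ be Puiseux monoids (that is, submonoids of $(\mathbb{Q}_{\ge 0},+)$) such that $N$ is finitely generated, and let $M+N = \{m+n : m \in M \text{ and } n \in N\}$ be their internal sum inside $\mathbb{Q}$. Then the following statements hold. (1) If $M$ is a finite factorization monoid (FFM), then $M+N$ is an FFM. (2) If $M$ is a bounded factorization monoid (BFM), then $M+N$ is a BFM. (3) If $M$ is a length-finite factorization monoid (LFFM), then $M+N$ is an LFFM.
   Context: A Puiseux monoid is an additive submonoid (containing $0$) of the nonnegative cone $\mathbb{Q}_{\ge 0}$ of $\mathbb{Q}$. All monoids are commutative and cancellative, written additively with identity $0$. For a monoid $M$, $\mathcal{U}(M)$ denotes its group of invertible elements (for a Puiseux monoid, $\mathcal{U}(M)=\{0\}$). A non-invertible element $a \in M$ is an atom if, for all $b,c \in M$, $a = b+c$ implies $b \in \mathcal{U}(M)$ or $c \in \mathcal{U}(M)$. The monoid $M$ is atomic if every non-invertible element of $M$ can be written as a sum of finitely many (possibly repeated) atoms of $M$. Let $M$ be an atomic monoid. A factorization of $q \in M \setminus \mathcal{U}(M)$ is a formal sum $z = a_1 + \dots + a_\ell$ of (possibly repeated) atoms of $M$ whose value is $q$; two factorizations are identified if they agree up to permutation of the atoms and replacement of atoms by associates (in a Puiseux monoid, associates are equal, so a factorization is a finite multiset of atoms with sum $q$). The length of $z$ is $|z| = \ell$. Each invertible element has exactly one factorization, namely the empty one, $0$ (of length $0$). Let $\mathsf{Z}(q)$ be the set of all factorizations of $q$ in $M$, $\mathsf{L}(q) = \{|z|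 : z \in \mathsf{Z}(q)\}$, and, for $\ell \in \mathbb{N} = \{1,2,\dots\}$, $\mathsf{Z}_\ell(q) = \{z \in \mathsf{Z}(q) : |z| = \ell\}$. An atomic monoid $M$ is: a finite factorization monoid (FFM) if $\mathsf{Z}(q)$ is finite for every $q \in M$; a bounded factorization monoid (BFM) if $\mathsf{L}(q)$ is finite for every $q \in M$; a length-finite factorization monoid (LFFM) if $\mathsf{Z}_\ell(q)$ is finite for every $q \in M$ and every $\ell \in \mathbb{N}$. (Each of these properties includes atomicity of $M$.) *)

theory Defs
  imports Complex_Main "HOL-Library.Multiset" "HOL-Library.Set_Algebras"
begin

definition submonoid :: "rat set \<Rightarrow> bool" where
  "submonoid M \<longleftrightarrow> 0 \<in> M \<and> (\<forall>x\<in>M. \<forall>y\<in>M. x + y \<in> M)"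

definition puiseux_monoid :: "rat set \<Rightarrow> bool" where
  "puiseux_monoid M \<longleftrightarrow> submonoid M \<and> M \<subseteq> {0..}"

definition finitely_generated :: "rat set \<Rightarrow> bool" where
  "finitely_generated M \<longleftrightarrow> (\<exists>S. finite S \<and> S \<subseteq> M \<and> submonoid hull S = M)"

definition units :: "rat set \<Rightarrow> rat set" where
  "units M = {a \<in> M. \<exists>b\<in>M. a + b = 0}"

definition atoms :: "rat set \<Rightarrow> rat set" where
  "atoms M = {a \<in> M - units M. \<forall>b\<in>M. \<forall>c\<in>M. a = b + c \<longrightarrow> b \<in> units M \<or> c \<in> units M}"

text \<open>Associates in a Puiseux monoid are equal, so a factorization is a multiset of atoms.
  Atoms are positive there, hence the only factorization of the unit 0 is the empty multiset.\<close>

definition factorizations :: "rat set \<Rightarrow> rat \<Rightarrow> rat multiset set" where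
  "factorizations M q = {z. set_mset z \<subseteq> atoms M \<and> \<Sum>\<^sub># z = q}"

definition lengths :: "rat set \<Rightarrow> rat \<Rightarrow> nat set" where
  "lengths M q = size ` factorizations M q"

definition factorizations_of_length :: "rat set \<Rightarrow> nat \<Rightarrow> rat \<Rightarrow> rat multiset set" where
  "factorizations_of_length M l q = {z \<in> factorizations M q. size z = l}"

definition atomic :: "rat set \<Rightarrow> bool" where
  "atomic M \<longleftrightarrow> puiseux_monoid M \<and> (\<forall>q \<in> M - units M. factorizations M q \<noteq> {})"

definition FFM :: "rat set \<Rightarrow> bool" where
  "FFM M \<longleftrightarrow> atomic M \<and> (\<forall>q\<in>M. finite (factorizations M q))"

definition BFM :: "rat set \<Rightarrow> bool" where
  "BFM M \<longleftrightarrow> atomic M \<and> (\<forall>q\<in>M. finite (lengths M q))"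

definition LFFM :: "rat set \<Rightarrow> bool" where
  "LFFM M \<longleftrightarrow> atomic M \<and> (\<forall>q\<in>M. \<forall>l\<ge>1. finite (factorizations_of_length M l q))"

end

theory Submission
  imports Defs
begin

text \<open>Adding one generator at a time, it is enough to treat \<open>M + \<nat>r\<close> with \<open>r > 0\<close> and \<open>r \<notin> M\<close>.
  Every atom of \<open>M + \<nat>r\<close> is either \<open>r\<close> or an atom of \<open>M\<close>, so a factorization of \<open>q\<close> in
  \<open>M + \<nat>r\<close> consists of \<open>i\<close> copies of \<open>r\<close> and a factorization of \<open>q - ir\<close> in \<open>M\<close>. Since
  \<open>ir \<le> q\<close> leaves only finitely many \<open>i\<close>, all three finiteness conditions carry over. For atomicity,
  take the largest \<open>k\<close> with \<open>q - kr \<in> M\<close>: by maximality, no atom in a factorization of \<open>q - kr\<close>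
  in \<open>M\<close> can be split in \<open>M + \<nat>r\<close> using a copy of \<open>r\<close>.\<close>

section \<open>Submonoids of the rationals: multiples of one element, sums, hulls\<close>

definition multiples :: "rat \<Rightarrow> rat set" where
  "multiples r = range (\<lambda>k. of_nat k * r)"

lemma of_nat_mult_in_multiples: "of_nat k * r \<in> multiples r"
  by (auto simp: multiples_def)

lemma submonoid_multiples: "submonoid (multiples r)"
  unfolding submonoid_def
proof (intro conjI ballI)
  show "0 \<in> multiples r"
    using of_nat_mult_in_multiples[of 0 r] by simp
  fix x y assume "x \<in> multiples r" "y \<in> multiples r"
  then obtain i j where "x = of_nat i * r" "y = of_nat j * r"
    by (auto simp: multiples_def)
  then have "x + y = of_nat (i + j) * r"
    by (simp add: algebra_simps)
  then show "x + y \<in> multiples r"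
    using of_nat_mult_in_multiples by metis
qed

lemma submonoid_set_plus:
  assumes "submonoid A" "submonoid B"
  shows "submonoid (A + B)"
  unfolding submonoid_def
proof (intro conjI ballI)
  show "0 \<in> A + B"
    using assms set_plus_intro[of 0 A 0 B] by (simp add: submonoid_def)
  fix x y assume "x \<in> A + B" "y \<in> A + B"
  then obtain a b c d where *: "x = a + b" "y = c + d" "a \<in> A" "c \<in> A" "b \<in> B" "d \<in> B"
    by (auto elim!: set_plus_elim)
  then have "x + y = (a + c) + (b + d)"
    by simp
  also have "\<dots> \<in> A + B"
    using * assms by (intro set_plus_intro) (auto simp: submonoid_def)
  finally show "x + y \<in> A + B" .
qed

lemma puiseux_monoid_set_plus:
  assumes "puiseux_monoid A" "puiseux_monoid B"
  shows "puiseux_monoid (A + B)"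
  using assms submonoid_set_plus unfolding puiseux_monoid_def
  by (fastforce elim!: set_plus_elim)

lemma puiseux_monoid_multiples: "r \<ge> 0 \<Longrightarrow> puiseux_monoid (multiples r)"
  using submonoid_multiples by (auto simp: puiseux_monoid_def multiples_def)

lemma submonoid_mult_of_nat: "submonoid M \<Longrightarrow> r \<in> M \<Longrightarrow> of_nat k * r \<in> M"
  by (induction k) (auto simp: submonoid_def algebra_simps)

lemma submonoid_hull: "submonoid (submonoid hull S)"
  by (rule hull_in) (auto simp: submonoid_def)

lemma submonoid_hull_empty: "submonoid hull {} = {0}"
  by (rule hull_unique) (auto simp: submonoid_def)

text \<open>This is what lets generators be adjoined one at a time. The right-hand side is a
  submonoid containing the generators, and any submonoid containing them is closed under the sums
  that make it up.\<close>

lemma submonoid_hull_insert: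
  "submonoid hull (insert r S) = submonoid hull S + multiples r"
proof (rule hull_unique)
  let ?H = "submonoid hull S"
  have 0: "0 \<in> ?H" "0 \<in> multiples r"
    using submonoid_hull submonoid_multiples by (auto simp: submonoid_def)
  have "r \<in> ?H + multiples r"
    using set_plus_intro[OF 0(1) of_nat_mult_in_multiples[of 1 r]] by simp
  moreover have "s \<in> ?H + multiples r" if "s \<in> S" for s
    using set_plus_intro[OF hull_inc[OF that] 0(2)] by simp
  ultimately show "insert r S \<subseteq> ?H + multiples r"
    by auto
  show "submonoid (?H + multiples r)"
    by (intro submonoid_set_plus submonoid_hull submonoid_multiples)
  fix T assume T: "insert r S \<subseteq> T" "submonoid T"
  have "?H \<subseteq> T"
    using T by (intro hull_minimal) auto
  moreover have "multiples r \<subseteq> T"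
    using T submonoid_mult_of_nat by (auto simp: multiples_def)
  ultimately show "?H + multiples r \<subseteq> T"
    using T(2) by (auto simp: submonoid_def elim!: set_plus_elim)
qed

section \<open>Units, atoms and sums in Puiseux monoids\<close>

lemma units_puiseux_monoid: "puiseux_monoid M \<Longrightarrow> units M = {0}"
  by (auto simp: units_def puiseux_monoid_def submonoid_def add_nonneg_eq_0_iff subset_iff)

lemma atoms_puiseux_monoid:
  assumes "puiseux_monoid M"
  shows "a \<in> atoms M \<longleftrightarrow>
    a \<in> M \<and> a \<noteq> 0 \<and> (\<forall>b\<in>M. \<forall>c\<in>M. a = b + c \<longrightarrow> b = 0 \<or> c = 0)"
  unfolding atoms_def units_puiseux_monoid[OF assms] by auto

lemma atoms_subset: "atoms M \<subseteq> M"
  by (auto simp: atoms_def)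

lemma sum_mset_in_submonoid: "submonoid M \<Longrightarrow> set_mset z \<subseteq> M \<Longrightarrow> \<Sum>\<^sub># z \<in> M"
  by (induction z) (auto simp: submonoid_def)

lemma finite_of_nat_mult_le:
  assumes "(r::rat) > 0"
  shows "finite {i. of_nat i * r \<le> q}"
proof (rule finite_subset)
  show "{i. of_nat i * r \<le> q} \<subseteq> {..nat \<lceil>q / r\<rceil>}"
  proof safe
    fix i assume "of_nat i * r \<le> q"
    then have "rat_of_nat i \<le> q / r"
      using assms by (simp add: field_simps)
    then have "int i \<le> \<lceil>q / r\<rceil>"
      by (metis ceiling_mono ceiling_of_nat)
    then show "i \<le> nat \<lceil>q / r\<rceil>"
      by linarith
  qed
qed simp

section \<open>Adjoining one positive generator outside the monoid\<close>

locale adjoin =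
  fixes M :: "rat set" and r :: rat
  assumes puiseux: "puiseux_monoid M" and pos: "r > 0" and not_in: "r \<notin> M"
begin

abbreviation M' :: "rat set" where "M' \<equiv> M + multiples r"

lemma puiseux': "puiseux_monoid M'"
  using puiseux pos by (intro puiseux_monoid_set_plus puiseux_monoid_multiples) auto

lemma in_M'_iff: "q \<in> M' \<longleftrightarrow> (\<exists>m\<in>M. \<exists>k. q = m + of_nat k * r)"
  by (auto simp: multiples_def set_plus_def)

lemma in_M'I: "m \<in> M \<Longrightarrow> m + of_nat k * r \<in> M'"
  using in_M'_iff by blast

lemma submonoid: "submonoid M" and nonneg: "m \<in> M \<Longrightarrow> m \<ge> 0"
  using puiseux by (auto simp: puiseux_monoid_def)

lemma zero_in: "0 \<in> M"
  using submonoid by (simp add: submonoid_def)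

lemma subset: "M \<subseteq> M'"
  using in_M'I[of _ 0] by auto

text \<open>Write an atom as \<open>m + of_nat k * r\<close>. If \<open>k = 0\<close>, it lies in
  \<open>M\<close>, and a splitting in \<open>M\<close> is also one in \<open>M'\<close>. If
  \<open>k > 0\<close>, indecomposability first forces \<open>m = 0\<close> and then leaves a single
  copy of \<open>r\<close>.\<close>

lemma atoms_M'_subset: "atoms M' \<subseteq> insert r (atoms M)"
proof
  fix a assume "a \<in> atoms M'"
  then have a: "a \<in> M'" "a \<noteq> 0"
    and split: "\<And>b c. b \<in> M' \<Longrightarrow> c \<in> M' \<Longrightarrow> a = b + c \<Longrightarrow> b = 0 \<or> c = 0"
    by (auto simp: atoms_puiseux_monoid[OF puiseux'])
  obtain m k where mk: "m \<in> M" "a = m + of_nat k * r"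
    using a in_M'_iff by blast
  have mult: "of_nat j * r \<in> M'" for j
    using in_M'I[OF zero_in, of j] by simp
  show "a \<in> insert r (atoms M)"
  proof (cases k)
    case 0
    then have "a \<in> atoms M"
      using mk a split subset unfolding atoms_puiseux_monoid[OF puiseux] by auto
    then show ?thesis by simp
  next
    case (Suc j)
    have "m = 0"
      using split[of m "of_nat k * r"] mk mult subset Suc pos by (auto simp del: of_nat_Suc)
    then have "a = r + of_nat j * r"
      using mk Suc by (simp add: algebra_simps)
    then have "a = r"
      using split[of r "of_nat j * r"] mult[of 1] mult[of j] pos by auto
    then show ?thesis by simp
  qed
qed

text \<open>If \<open>r\<close> were a sum of two nonzero elements, both would be smaller than
  \<open>r\<close>. Such elements of \<open>M'\<close> use no copy of \<open>r\<close>, so both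
  would lie in \<open>M\<close>, and hence so would \<open>r\<close>, against
  \<open>not_in\<close>.\<close>

lemma generator_atom: "r \<in> atoms M'"
proof -
  have "r \<in> M'"
    using in_M'I[OF zero_in, of 1] by simp
  moreover have "b = 0 \<or> c = 0" if bc: "b \<in> M'" "c \<in> M'" "r = b + c" for b c
  proof (rule ccontr)
    assume "\<not> (b = 0 \<or> c = 0)"
    then have "b \<noteq> 0" "c \<noteq> 0"
      by auto
    moreover have "b \<ge> 0" "c \<ge> 0"
      using bc puiseux' by (auto simp: puiseux_monoid_def)
    ultimately have less: "b < r" "c < r"
      using bc(3) by linarith+
    have "d \<in> M" if d: "d \<in> M'" "d < r" for d
    proof -
      obtain m k where mk: "m \<in> M" "d = m + of_nat k * r"
        using d(1) in_M'_iff by blast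
      have "of_nat k * r < 1 * r"
        using mk nonneg[of m] d(2) by simp
      then have "k = 0"
        using pos by (simp add: mult_less_cancel_right)
      then show ?thesis using mk by simp
    qed
    then have "r \<in> M"
      using less bc submonoid by (auto simp: submonoid_def)
    then show False using not_in by simp
  qed
  ultimately show ?thesis
    using pos by (auto simp: atoms_puiseux_monoid[OF puiseux'])
qed

text \<open>The finiteness hypotheses on \<open>M\<close> cover only its own elements, while
  \<open>q - of_nat i * r\<close> may fall outside \<open>M\<close> or even be negative. Such values
  contribute no factorizations.\<close>

lemma factorizations_outside:
  assumes "q \<notin> M"
  shows "factorizations M q = {}"
proof -
  have "\<Sum>\<^sub># z \<in> M" if "set_mset z \<subseteq> atoms M" for z
    using that atoms_subset by (intro sum_mset_in_submonoid submonoid) blast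
  then show ?thesis
    using assms by (auto simp: factorizations_def)
qed

lemma factorization_M'_cases:
  assumes "z \<in> factorizations M' q"
  obtains i y where "of_nat i * r \<le> q" "y \<in> factorizations M (q - of_nat i * r)"
    "z = y + replicate_mset i r"
proof
  \<comment> \<open>All copies of \<open>r\<close> are removed, so every atom left in
    \<open>y\<close> must be an atom of \<open>M\<close>.\<close>
  define y i where "y = filter_mset (\<lambda>a. a \<noteq> r) z" and "i = count z r"
  have "z = y + filter_mset (\<lambda>a. a = r) z"
    unfolding y_def by (metis multiset_partition union_commute)
  then show z: "z = y + replicate_mset i r"
    by (simp add: i_def filter_eq_replicate_mset)
  have "set_mset z \<subseteq> atoms M'" and sum: "\<Sum>\<^sub># z = q"
    using assms by (auto simp: factorizations_def)
  then have y: "set_mset y \<subseteq> atoms M"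
    using atoms_M'_subset by (auto simp: y_def)
  have "\<Sum>\<^sub># y \<in> M"
    using y atoms_subset submonoid by (intro sum_mset_in_submonoid) auto
  moreover have sum_y: "\<Sum>\<^sub># y = q - of_nat i * r"
    using sum unfolding z by (simp add: sum_mset_replicate_mset)
  ultimately show "of_nat i * r \<le> q"
    using nonneg by fastforce
  show "y \<in> factorizations M (q - of_nat i * r)"
    using y sum_y by (simp add: factorizations_def)
qed

lemma atomic:
  assumes "atomic M"
  shows "atomic M'"
  unfolding atomic_def
proof (intro conjI ballI puiseux')
  fix q assume "q \<in> M' - units M'"
  define K where "K = {k. q - of_nat k * r \<in> M}"
  obtain m i where "m \<in> M" "q = m + of_nat i * r"
    using \<open>q \<in> M' - units M'\<close> by (auto simp: in_M'_iff)
  then have "i \<in> K"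
    by (simp add: K_def)
  moreover have "K \<subseteq> {k. of_nat k * r \<le> q}"
    using nonneg by (fastforce simp: K_def)
  then have "finite K"
    using finite_of_nat_mult_le[OF pos] finite_subset by blast
  ultimately have "Max K \<in> K" and max: "\<And>k. k \<in> K \<Longrightarrow> k \<le> Max K"
    using Max_in by auto
  define k where "k = Max K"
  have "q - of_nat k * r \<in> M"
    using \<open>Max K \<in> K\<close> by (simp add: K_def k_def)
  \<comment> \<open>Atomicity says nothing about the unit 0, which has the empty
    factorization.\<close>
  have "factorizations M (q - of_nat k * r) \<noteq> {}"
  proof (cases "q - of_nat k * r = 0")
    case True
    then have "{#} \<in> factorizations M (q - of_nat k * r)"
      by (simp add: factorizations_def)
    then show ?thesis by blast
  next
    case False
    then show ?thesis
      using assms \<open>q - of_nat k * r \<in> M\<close> units_puiseux_monoid[OF puiseux]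
      by (simp add: atomic_def)
  qed
  then obtain y where y: "set_mset y \<subseteq> atoms M" "\<Sum>\<^sub># y = q - of_nat k * r"
    by (auto simp: factorizations_def)
  have "a \<in> atoms M'" if "a \<in># y" for a
  proof -
    have a: "a \<in> M" "a \<noteq> 0"
      and split: "\<And>b c. b \<in> M \<Longrightarrow> c \<in> M \<Longrightarrow> a = b + c \<Longrightarrow> b = 0 \<or> c = 0"
      using that y(1) atoms_puiseux_monoid[OF puiseux] by auto
    obtain x where x: "y = add_mset a x"
      using \<open>a \<in># y\<close> by (blast dest: multi_member_split)
    have rest: "\<Sum>\<^sub># x \<in> M"
      using y(1) x atoms_subset submonoid by (intro sum_mset_in_submonoid) auto
    have "b = 0 \<or> c = 0" if bc: "b \<in> M'" "c \<in> M'" "a = b + c" for b c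
    proof -
      obtain m i n j where mn: "m \<in> M" "b = m + of_nat i * r" "n \<in> M" "c = n + of_nat j * r"
        using bc(1,2) by (auto simp: in_M'_iff)
      \<comment> \<open>Replacing \<open>a\<close> by \<open>b + c\<close> brings in
        \<open>i + j\<close> further copies of \<open>r\<close>. What remains of \<open>q\<close>
        still lies in \<open>M\<close>, so maximality of \<open>k\<close> gives
        \<open>i = j = 0\<close>. Then \<open>b\<close> and \<open>c\<close> lie in
        \<open>M\<close>, where \<open>a\<close> is an atom.\<close>
      have "q - of_nat (k + i + j) * r = (m + n) + \<Sum>\<^sub># x"
        using y(2) x bc(3) mn by (simp add: algebra_simps)
      also have "\<dots> \<in> M"
        using mn rest submonoid by (simp add: submonoid_def)
      finally have "k + i + j \<le> k"
        using max unfolding K_def k_def by simp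
      then show ?thesis
        using split[of b c] mn bc(3) by simp
    qed
    then show ?thesis
      using a subset by (auto simp: atoms_puiseux_monoid[OF puiseux'])
  qed
  then have "y + replicate_mset k r \<in> factorizations M' q"
    using y(2) generator_atom
    by (auto simp: factorizations_def sum_mset_replicate_mset in_replicate_mset)
  then show "factorizations M' q \<noteq> {}"
    by blast
qed

lemma FFM:
  assumes "FFM M"
  shows "FFM M'"
  unfolding FFM_def
proof (intro conjI ballI)
  show "atomic M'"
    using assms atomic by (simp add: FFM_def)
  fix q
  have "factorizations M' q \<subseteq> (\<Union>i\<in>{i. of_nat i * r \<le> q}.
      (\<lambda>y. y + replicate_mset i r) ` factorizations M (q - of_nat i * r))"
    by (auto elim!: factorization_M'_cases)
  moreover have "finite (factorizations M p)" for p
    using assms factorizations_outside[of p] by (cases "p \<in> M") (auto simp: FFM_def)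
  ultimately show "finite (factorizations M' q)"
    using finite_of_nat_mult_le[OF pos] by (elim finite_subset) auto
qed

lemma BFM:
  assumes "BFM M"
  shows "BFM M'"
  unfolding BFM_def
proof (intro conjI ballI)
  show "atomic M'"
    using assms atomic by (simp add: BFM_def)
  fix q
  have "lengths M' q \<subseteq> (\<Union>i\<in>{i. of_nat i * r \<le> q}.
      (\<lambda>l. l + i) ` lengths M (q - of_nat i * r))"
    by (fastforce simp: lengths_def elim!: factorization_M'_cases)
  moreover have "finite (lengths M p)" for p
    using assms factorizations_outside[of p] by (cases "p \<in> M") (auto simp: BFM_def lengths_def)
  ultimately show "finite (lengths M' q)"
    using finite_of_nat_mult_le[OF pos] by (elim finite_subset) auto
qed

lemma LFFM:
  assumes "LFFM M"
  shows "LFFM M'"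
  unfolding LFFM_def
proof (intro conjI ballI allI impI)
  show "atomic M'"
    using assms atomic by (simp add: LFFM_def)
  fix q and l :: nat
  \<comment> \<open>A factorization of length \<open>l\<close> with \<open>i\<close> copies of
    \<open>r\<close> has \<open>i \<le> l\<close>, so \<open>l - i\<close> is the true length of the
    rest. Indices \<open>i > l\<close> only enlarge the union, and an inclusion suffices.\<close>
  have "factorizations_of_length M' l q \<subseteq> (\<Union>i\<in>{i. of_nat i * r \<le> q}.
      (\<lambda>y. y + replicate_mset i r) ` factorizations_of_length M (l - i) (q - of_nat i * r))"
    by (fastforce simp: factorizations_of_length_def elim!: factorization_M'_cases)
  moreover have "finite (factorizations_of_length M n p)" for n p
  \<comment> \<open>Length 0 occurs when \<open>l = i\<close> but is not covered by
    \<open>LFFM\<close>; only the empty multiset has it.\<close>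
  proof (cases "n = 0")
    case True
    have "factorizations_of_length M 0 p \<subseteq> {{#}}"
      by (auto simp: factorizations_of_length_def)
    then show ?thesis
      using True finite_subset by blast
  next
    case False
    then show ?thesis
      using assms factorizations_outside[of p]
      by (cases "p \<in> M") (auto simp: LFFM_def factorizations_of_length_def)
  qed
  ultimately show "finite (factorizations_of_length M' l q)"
    using finite_of_nat_mult_le[OF pos] by (elim finite_subset) auto
qed

end

section \<open>Induction over the generators\<close>

lemma set_plus_multiples_absorb:
  assumes "submonoid M" "r \<in> M"
  shows "M + multiples r = M"
proof
  show "M + multiples r \<subseteq> M"
    using assms submonoid_mult_of_nat
    by (auto simp: submonoid_def multiples_def elim!: set_plus_elim)
  show "M \<subseteq> M + multiples r"
    using submonoid_multiples set_zero_plus2[of "multiples r" M]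
    by (simp add: submonoid_def add.commute)
qed

text \<open>The property \<open>P\<close> is left abstract so that one induction serves all three
  finiteness conditions. Being a Puiseux monoid is carried along because each application of
  \<open>step\<close> requires it.\<close>

lemma set_plus_hull_induct:
  assumes "finite S" "S \<subseteq> {0..}" "puiseux_monoid M" "P M"
    and step: "\<And>M r. adjoin M r \<Longrightarrow> P M \<Longrightarrow> P (M + multiples r)"
  shows "puiseux_monoid (M + submonoid hull S) \<and> P (M + submonoid hull S)"
  using assms(1,2)
proof (induction S rule: finite_induct)
  case empty
  have "M + {0} = M"
    by (simp add: set_plus_def)
  then show ?case
    using assms(3,4) by (simp add: submonoid_hull_empty)
next
  case (insert r S)
  define A where "A = M + submonoid hull S"
  have A: "puiseux_monoid A" "P A" and "r \<ge> 0"
    using insert by (auto simp: A_def)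
  have eq: "M + submonoid hull (insert r S) = A + multiples r"
    by (simp add: A_def submonoid_hull_insert add.assoc)
  show ?case
  proof (cases "r \<in> A")
    case True
    then have "A + multiples r = A"
      using A by (intro set_plus_multiples_absorb) (simp add: puiseux_monoid_def)
    then show ?thesis
      using A eq by simp
  next
    case False
    \<comment> \<open>Since \<open>A\<close> contains 0 but not \<open>r\<close>, the generator is
      nonzero and therefore positive.\<close>
    moreover have "0 \<in> A"
      using A by (simp add: puiseux_monoid_def submonoid_def)
    ultimately have "adjoin A r"
      using A \<open>r \<ge> 0\<close> by unfold_locales (auto simp: order_less_le)
    then show ?thesis
      using A step adjoin.puiseux' unfolding eq by blast
  qed
qed

theorem theorem4p1:
  fixes M N :: "rat set"
  assumes "puiseux_monoid M" and "puiseux_monoid N" and "finitely_generated N"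
  shows "(FFM M \<longrightarrow> FFM (M + N)) \<and> (BFM M \<longrightarrow> BFM (M + N)) \<and> (LFFM M \<longrightarrow> LFFM (M + N))"
proof -
  obtain S where S: "finite S" "S \<subseteq> N" "submonoid hull S = N"
    using assms(3) by (auto simp: finitely_generated_def)
  then have "S \<subseteq> {0..}"
    using assms(2) by (auto simp: puiseux_monoid_def)
  note induct = set_plus_hull_induct[OF S(1) this assms(1), unfolded S(3)]
  show ?thesis
    using induct[of FFM] induct[of BFM] induct[of LFFM] adjoin.FFM adjoin.BFM adjoin.LFFM
    by blast
qed

end
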